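(* Let $\mathrm{AG}$ be a finite nonempty set of agents, and let $X\in\{\epsilon,\mathtt S,\mathtt D,\mathtt{SD}\}$. Let $\mathcal A=(\mathrm{ST},\{A_C\}_{C\subseteq\mathrm{AG}})$ be an $\alpha$-representative alpha neighborhood $X$-frame. Then there exists a general concurrent game $X$-frame $G=(\mathrm{ST},\mathrm{AC},\{\mathrm{av}_C\}_{C\subseteq \mathrm{AG}},\{\mathrm{out}_C\}_{C\subseteq \mathrm{AG}})$ (with the same state set) such that $G$ is $\alpha$-representable by $\mathcal A$, i.e. for every $s\in\mathrm{ST}$ and every $C\subseteq\mathrm{AG}$, $$A_C(s)=\{Y\subseteq\mathrm{ST}\mid \mathrm{out}_C(s,\sigma_C)\subseteq Y\text{ for some }\sigma_C\in\mathrm{av}_C(s)\}.$$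
   Context: Let $\mathrm{AG}$ be a finite nonempty set of agents; coalitions are subsets of $\mathrm{AG}$. **Game frames.** Given a nonempty action set $\mathrm{AC}$, $\mathrm{JA}_C$ is the set of functions $C\to\mathrm{AC}$ (so $\mathrm{JA}_\emptyset=\{\emptyset\}$); $\sigma|_C$ denotes restriction. An action frame is $(\mathrm{ST},\mathrm{AC},\{\mathrm{av}_C\}_{C\subseteq\mathrm{AG}},\{\mathrm{out}_C\}_{C\subseteq\mathrm{AG}})$ with $\mathrm{ST}$ and $\mathrm{AC}$ nonempty sets, $\mathrm{av}_C:\mathrm{ST}\to\mathcal P(\mathrm{JA}_C)$ and $\mathrm{out}_C:\mathrm{ST}\times\mathrm{JA}_C\to\mathcal P(\mathrm{ST})$. The action set $\mathrm{AC}$ may vary from frame to frame and need not be finite. It is a general concurrent game frame if for all $C\subseteq\mathrm{AG}$, $s\in\mathrm{ST}$: (GCI) for all $\sigma_C\in\mathrm{JA}_C$, $\mathrm{out}_C(s,\sigma_C)=\bigcup\{\mathrm{out}_{\mathrm{AG}}(s,\sigma)\mid\sigma\in\mathrm{JA}_{\mathrm{AG}},\ \sigma|_C=\sigma_C\}$; (ODA) $\mathrm{av}_C(s)=\{\sigma_C\in\mathrm{JA}_C\mid\mathrm{out}_C(s,\sigma_C)\neq\emptyset\}$. It is serial ($\mathtt S$) if $\mathrm{av}_C(s)\ne\emptyset$ for all $C,s$; deterministic ($\mathtt D$) if $\mathrm{out}_{\mathrm{AG}}(s,\sigma)$ is a singleton for all $s$ and $\sigma\in\mathrm{av}_{\mathrm{AG}}(s)$.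 For $X\in\{\epsilon,\mathtt S,\mathtt D,\mathtt{SD}\}$ ($\epsilon$ is the empty string), a general concurrent game $X$-frame is a general concurrent game frame having every property whose symbol occurs in $X$ (the omitted properties are not required to fail). **Alpha neighborhood frames.** An alpha neighborhood frame is $\mathcal A=(\mathrm{ST},\{A_C\}_{C\subseteq\mathrm{AG}})$ with $\mathrm{ST}$ a nonempty set and $A_C:\mathrm{ST}\to\mathcal P(\mathcal P(\mathrm{ST}))$ such that each $A_C(s)$ is closed under supersets (within $\mathrm{ST}$). Its nonmonotonic core $\mathrm{Core}A_C(s)$ is the set of $\subseteq$-minimal elements of $A_C(s)$. $\mathcal A$ is $\alpha$-representative if for all $s\in\mathrm{ST}$: (1) if $A_\emptyset(s)\neq\emptyset$ then $\mathrm{Core}A_\emptyset(s)$ is a singleton; (2) $\emptyset\notin A_C(s)$ for all $C\subseteq\mathrm{AG}$; (3) for all $C$ and all $Z\in A_C(s)$ there is $Y\in A_C(s)$ with $Y\subseteq\bigcup\mathrm{Core}A_\emptyset(s)$ and $Y\subseteq Z$; (4) $A_C(s)\subseteq A_D(s)$ whenever $C\subseteq D\subseteq\mathrm{AG}$. An $\alpha$-representative $\mathcal A$ is $\alpha$-serial ($\mathtt S$) if $A_C(s)\neq\emptyset$ for all $s,C$; $\alpha$-deterministic ($\mathtt D$) if for all $s$: (a) every element of $\mathrm{Core}A_{\mathrm{AG}}(s)$ is a singleton, and (b) $\bigcup\mathrm{Core}A_\emptyset(s)\subseteq\bigcup\mathrm{Core}A_{\mathrm{AG}}(s)$. An $\alpha$-representative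 alpha neighborhood $X$-frame is an $\alpha$-representative alpha neighborhood frame having every $\alpha$-property whose symbol occurs in $X$. *)

theory Defs
  imports Main "HOL-Library.FuncSet"
begin

text \<open>
  Agents, states and actions are given by carrier sets inside types. Families indexed by a
  coalition \<open>C \<subseteq> AG\<close> and a state \<open>s \<in> ST\<close> are total HOL functions, of which only the
  values at such \<open>C\<close> and \<open>s\<close> (and, for outcomes, at joint actions of \<open>C\<close>) matter.
\<close>

datatype frame_symbol = Serial | Deterministic

text \<open>
  The four strings \<open>\<epsilon>\<close>, \<open>S\<close>, \<open>D\<close>, \<open>SD\<close> are the four elements of
  \<^typ>\<open>frame_symbol set\<close>.
\<close>


subsection \<open>Game frames\<close>

record ('s, 'ag, 'act) action_frame =
  ST :: "'s set"
  AC :: "'act set"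
  av :: "'ag set \<Rightarrow> 's \<Rightarrow> ('ag \<Rightarrow> 'act) set"
  out :: "'ag set \<Rightarrow> 's \<Rightarrow> ('ag \<Rightarrow> 'act) \<Rightarrow> 's set"

text \<open>Functions \<open>C \<rightarrow> AC\<close> are represented by their extensional (\<^const>\<open>undefined\<close> outside
  \<open>C\<close>) total extensions, so that \<open>JA G {}\<close> has exactly one element.\<close>

definition JA :: "('s, 'ag, 'act) action_frame \<Rightarrow> 'ag set \<Rightarrow> ('ag \<Rightarrow> 'act) set" where
  "JA G C = (C \<rightarrow>\<^sub>E AC G)"

definition is_action_frame :: "'ag set \<Rightarrow> ('s, 'ag, 'act) action_frame \<Rightarrow> bool" where
  "is_action_frame AG G \<longleftrightarrow>
     ST G \<noteq> {} \<and> AC G \<noteq> {} \<and>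
     (\<forall>C s. C \<subseteq> AG \<longrightarrow> s \<in> ST G \<longrightarrow> av G C s \<subseteq> JA G C) \<and>
     (\<forall>C s. C \<subseteq> AG \<longrightarrow> s \<in> ST G \<longrightarrow> (\<forall>\<sigma>\<in>JA G C. out G C s \<sigma> \<subseteq> ST G))"

definition GCI :: "'ag set \<Rightarrow> ('s, 'ag, 'act) action_frame \<Rightarrow> bool" where
  "GCI AG G \<longleftrightarrow>
     (\<forall>C s. C \<subseteq> AG \<longrightarrow> s \<in> ST G \<longrightarrow>
        (\<forall>\<sigma>\<^sub>C\<in>JA G C. out G C s \<sigma>\<^sub>C = \<Union>{out G AG s \<sigma> | \<sigma>. \<sigma> \<in> JA G AG \<and> restrict \<sigma> C = \<sigma>\<^sub>C}))"

definition ODA :: "'ag set \<Rightarrow> ('s, 'ag, 'act) action_frame \<Rightarrow> bool" where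
  "ODA AG G \<longleftrightarrow>
     (\<forall>C s. C \<subseteq> AG \<longrightarrow> s \<in> ST G \<longrightarrow> av G C s = {\<sigma>\<^sub>C \<in> JA G C. out G C s \<sigma>\<^sub>C \<noteq> {}})"

definition general_concurrent_game_frame ::
    "'ag set \<Rightarrow> ('s, 'ag, 'act) action_frame \<Rightarrow> bool" where
  "general_concurrent_game_frame AG G \<longleftrightarrow> is_action_frame AG G \<and> GCI AG G \<and> ODA AG G"

definition serial :: "'ag set \<Rightarrow> ('s, 'ag, 'act) action_frame \<Rightarrow> bool" where
  "serial AG G \<longleftrightarrow> (\<forall>C s. C \<subseteq> AG \<longrightarrow> s \<in> ST G \<longrightarrow> av G C s \<noteq> {})"

definition deterministic :: "'ag set \<Rightarrow> ('s, 'ag, 'act) action_frame \<Rightarrow> bool" where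
  "deterministic AG G \<longleftrightarrow> (\<forall>s\<in>ST G. \<forall>\<sigma>\<in>av G AG s. is_singleton (out G AG s \<sigma>))"

definition general_concurrent_game_X_frame ::
    "frame_symbol set \<Rightarrow> 'ag set \<Rightarrow> ('s, 'ag, 'act) action_frame \<Rightarrow> bool" where
  "general_concurrent_game_X_frame X AG G \<longleftrightarrow>
     general_concurrent_game_frame AG G \<and>
     (Serial \<in> X \<longrightarrow> serial AG G) \<and>
     (Deterministic \<in> X \<longrightarrow> deterministic AG G)"


subsection \<open>Alpha neighborhood frames\<close>

record ('s, 'ag) alpha_frame =
  aST :: "'s set"
  anb :: "'ag set \<Rightarrow> 's \<Rightarrow> 's set set"

definition alpha_neighborhood_frame :: "'ag set \<Rightarrow> ('s, 'ag) alpha_frame \<Rightarrow> bool" where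
  "alpha_neighborhood_frame AG \<A> \<longleftrightarrow>
     aST \<A> \<noteq> {} \<and>
     (\<forall>C s. C \<subseteq> AG \<longrightarrow> s \<in> aST \<A> \<longrightarrow>
        anb \<A> C s \<subseteq> Pow (aST \<A>) \<and>
        (\<forall>Y Z. Y \<in> anb \<A> C s \<longrightarrow> Y \<subseteq> Z \<longrightarrow> Z \<subseteq> aST \<A> \<longrightarrow> Z \<in> anb \<A> C s))"

definition Core :: "('s, 'ag) alpha_frame \<Rightarrow> 'ag set \<Rightarrow> 's \<Rightarrow> 's set set" where
  "Core \<A> C s = {Y \<in> anb \<A> C s. \<not> (\<exists>Z\<in>anb \<A> C s. Z \<subset> Y)}"

definition alpha_representative :: "'ag set \<Rightarrow> ('s, 'ag) alpha_frame \<Rightarrow> bool" where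
  "alpha_representative AG \<A> \<longleftrightarrow>
     alpha_neighborhood_frame AG \<A> \<and>
     (\<forall>s\<in>aST \<A>.
        (anb \<A> {} s \<noteq> {} \<longrightarrow> is_singleton (Core \<A> {} s)) \<and>
        (\<forall>C. C \<subseteq> AG \<longrightarrow> {} \<notin> anb \<A> C s) \<and>
        (\<forall>C. C \<subseteq> AG \<longrightarrow>
           (\<forall>Z\<in>anb \<A> C s. \<exists>Y\<in>anb \<A> C s. Y \<subseteq> \<Union>(Core \<A> {} s) \<and> Y \<subseteq> Z)) \<and>
        (\<forall>C D. C \<subseteq> D \<longrightarrow> D \<subseteq> AG \<longrightarrow> anb \<A> C s \<subseteq> anb \<A> D s))"

definition alpha_serial :: "'ag set \<Rightarrow> ('s, 'ag) alpha_frame \<Rightarrow> bool" where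
  "alpha_serial AG \<A> \<longleftrightarrow> (\<forall>s\<in>aST \<A>. \<forall>C. C \<subseteq> AG \<longrightarrow> anb \<A> C s \<noteq> {})"

definition alpha_deterministic :: "'ag set \<Rightarrow> ('s, 'ag) alpha_frame \<Rightarrow> bool" where
  "alpha_deterministic AG \<A> \<longleftrightarrow>
     (\<forall>s\<in>aST \<A>.
        (\<forall>Y\<in>Core \<A> AG s. is_singleton Y) \<and>
        \<Union>(Core \<A> {} s) \<subseteq> \<Union>(Core \<A> AG s))"

definition alpha_representative_X_frame ::
    "frame_symbol set \<Rightarrow> 'ag set \<Rightarrow> ('s, 'ag) alpha_frame \<Rightarrow> bool" where
  "alpha_representative_X_frame X AG \<A> \<longleftrightarrow>
     alpha_representative AG \<A> \<and>
     (Serial \<in> X \<longrightarrow> alpha_serial AG \<A>) \<and>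
     (Deterministic \<in> X \<longrightarrow> alpha_deterministic AG \<A>)"


subsection \<open>Representation\<close>

definition alpha_representable_by ::
    "'ag set \<Rightarrow> ('s, 'ag, 'act) action_frame \<Rightarrow> ('s, 'ag) alpha_frame \<Rightarrow> bool" where
  "alpha_representable_by AG G \<A> \<longleftrightarrow>
     ST G = aST \<A> \<and>
     (\<forall>s\<in>aST \<A>. \<forall>C. C \<subseteq> AG \<longrightarrow>
        anb \<A> C s = {Y. Y \<subseteq> aST \<A> \<and> (\<exists>\<sigma>\<^sub>C\<in>av G C s. out G C s \<sigma>\<^sub>C \<subseteq> Y)})"

text \<open>
  HOL has no existential quantification over types, so a claim that some frame exists must
  name the type in which its action set lives. This type depends only on the types of agents
  and states; the action set is an arbitrary nonempty subset of it, not all of it. It is large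
  enough for an action to carry a coalition, a set of states, a state and a natural number.
\<close>

type_synonym ('s, 'ag) rep_action = "'ag set \<times> 's set \<times> 's \<times> nat"

end

theory Submission
  imports Defs
begin

text \<open>
  An action \<open>(B, Y, w, n)\<close> reads: ``let coalition \<open>B\<close> force \<open>Y\<close>; should I be the one to
  draw the outcome, it is \<open>w\<close>; my bid for drawing it is \<open>n\<close>''. A proposal \<open>(B, Y)\<close> with
  \<open>Y \<in> A\<^bsub>B\<^esub>(s)\<close> is enacted if all of \<open>B\<close> make it. With \<open>W = \<Union>Core A\<^bsub>\<emptyset>\<^esub>(s)\<close>, a full profile
  allows \<open>W\<close> if nothing is enacted, \<open>W \<inter> Y\<close> if exactly one proposal \<open>(B, Y)\<close> is, and nothing
  if several are. Players outside \<open>C\<close> may make no proposal, so \<open>C\<close> forces exactly the set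
  determined by the proposals enacted within \<open>C\<close>, and that set is empty or belongs to \<open>A\<^bsub>C\<^esub>(s)\<close>.
  For determinism the outcome is cut down to the state named by the unique highest bidder:
  a player outside \<open>C\<close> can always outbid \<open>C\<close>, so this affects only the grand coalition, for
  which all \<open>{w}\<close> with \<open>w \<in> W\<close> are in the neighborhood anyway.
\<close>

section \<open>The representing frame\<close>

definition enacted :: "('ag set \<Rightarrow> 's set set) \<Rightarrow> 'ag set \<Rightarrow> ('ag \<Rightarrow> ('s, 'ag) rep_action)
    \<Rightarrow> ('ag set \<times> 's set) set" where
  "enacted N C \<sigma> = {(B, Y). B \<noteq> {} \<and> B \<subseteq> C \<and> Y \<in> N B \<and> (\<forall>a\<in>B. \<exists>w n. \<sigma> a = (B, Y, w, n))}"

text \<open>Demanding \<open>P \<subseteq> {p}\<close> of each \<open>p \<in> P\<close> says that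
  \<open>P\<close> has at most one element, so no case distinction is needed.\<close>

definition allowed :: "'s set \<Rightarrow> ('ag set \<times> 's set) set \<Rightarrow> 's set" where
  "allowed W P = {w \<in> W. \<forall>p\<in>P. P \<subseteq> {p} \<and> w \<in> snd p}"

text \<open>Bids are compared strictly: a tie for the highest bid draws nothing, and a deterministic
  profile with such a tie has empty outcome.\<close>

definition drawn :: "'ag set \<Rightarrow> ('ag \<Rightarrow> ('s, 'ag) rep_action) \<Rightarrow> 's set" where
  "drawn AG \<sigma> = {w. \<exists>a\<in>AG. \<exists>B Y n. \<sigma> a = (B, Y, w, n) \<and>
     (\<forall>b\<in>AG - {a}. snd (snd (snd (\<sigma> b))) < n)}"

definition profile_outcome :: "bool \<Rightarrow> 'ag set \<Rightarrow> ('ag set \<Rightarrow> 's set set) \<Rightarrow> 's set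
    \<Rightarrow> ('ag \<Rightarrow> ('s, 'ag) rep_action) \<Rightarrow> 's set" where
  "profile_outcome det AG N W \<sigma> =
     allowed W (enacted N AG \<sigma>) \<inter> (if det then drawn AG \<sigma> else UNIV)"

definition coalition_outcome :: "bool \<Rightarrow> 'ag set \<Rightarrow> ('ag set \<Rightarrow> 's set set) \<Rightarrow> 's set
    \<Rightarrow> 'ag set \<Rightarrow> ('ag \<Rightarrow> ('s, 'ag) rep_action) \<Rightarrow> 's set" where
  "coalition_outcome det AG N W C \<sigma> =
     \<Union>{profile_outcome det AG N W \<tau> | \<tau>. \<tau> \<in> (AG \<rightarrow>\<^sub>E UNIV) \<and> restrict \<tau> C = \<sigma>}"

definition representing_frame :: "bool \<Rightarrow> 'ag set \<Rightarrow> ('s, 'ag) alpha_frame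
    \<Rightarrow> ('s, 'ag, ('s, 'ag) rep_action) action_frame" where
  "representing_frame det AG \<A> =
     (let f = (\<lambda>C s. coalition_outcome det AG (\<lambda>B. anb \<A> B s) (\<Union>(Core \<A> {} s)) C) in
      \<lparr>ST = aST \<A>, AC = UNIV, av = \<lambda>C s. {\<sigma> \<in> C \<rightarrow>\<^sub>E UNIV. f C s \<sigma> \<noteq> {}}, out = f\<rparr>)"

section \<open>Proposals, draws and what a coalition forces\<close>

lemma allowed_subset: "allowed W P \<subseteq> W"
  by (auto simp: allowed_def)

lemma allowed_antimono: "P \<subseteq> Q \<Longrightarrow> allowed W Q \<subseteq> allowed W P"
  unfolding allowed_def by blast

lemma allowed_empty [simp]: "allowed W {} = W"
  by (simp add: allowed_def)

lemma allowed_singleton [simp]: "allowed W {p} = W \<inter> snd p"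
  by (auto simp: allowed_def)

lemma allowed_nonempty_cases:
  assumes "allowed W P \<noteq> {}"
  obtains "P = {}" | p where "P = {p}"
  using assms unfolding allowed_def by blast

text \<open>Whether a proposal of \<open>B \<subseteq> C\<close> is enacted depends only on the
  actions of members of \<open>C\<close>.\<close>

lemma enacted_mono_restrict:
  assumes "C \<subseteq> D"
  shows "enacted N C (restrict \<tau> C) \<subseteq> enacted N D \<tau>"
  using assms by (fastforce simp: enacted_def subset_iff)

text \<open>Two different drawing agents would each bid strictly less than the other.\<close>

lemma drawn_unique: "w \<in> drawn AG \<sigma> \<Longrightarrow> w' \<in> drawn AG \<sigma> \<Longrightarrow> w = w'"
  unfolding drawn_def by clarify (metis DiffI less_asym' prod.inject singletonD snd_conv)

lemma coalition_outcome_grand: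
  assumes "\<sigma> \<in> AG \<rightarrow>\<^sub>E UNIV"
  shows "coalition_outcome det AG N W AG \<sigma> = profile_outcome det AG N W \<sigma>"
proof -
  have "{profile_outcome det AG N W \<tau> | \<tau>. \<tau> \<in> (AG \<rightarrow>\<^sub>E UNIV) \<and> restrict \<tau> AG = \<sigma>}
      = {profile_outcome det AG N W \<sigma>}"
    using assms by (auto simp: PiE_restrict)
  then show ?thesis by (simp add: coalition_outcome_def)
qed

text \<open>Some agent \<open>a\<close> outside \<open>C\<close> names \<open>w\<close> and bids
  above the finitely many bids in \<open>C\<close>; the remaining outsiders bid 0. Naming the
  coalition \<open>{}\<close> serves as abstention, since \<open>enacted\<close> counts only
  nonempty \<open>B\<close>.\<close>

lemma abstaining_extension:
  assumes "finite AG" "C \<subset> AG" "\<sigma> \<in> C \<rightarrow>\<^sub>E UNIV"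
  obtains \<tau> where "\<tau> \<in> AG \<rightarrow>\<^sub>E UNIV" "restrict \<tau> C = \<sigma>"
    "enacted N AG \<tau> = enacted N C \<sigma>" "w \<in> drawn AG \<tau>"
proof -
  obtain a where a: "a \<in> AG" "a \<notin> C" using assms(2) by blast
  define bid where "bid b = snd (snd (snd (\<sigma> b)))" for b
  obtain m where m: "\<And>b. b \<in> C \<Longrightarrow> bid b \<le> m"
    using finite_subset[of C AG] assms(1,2) finite_nat_set_iff_bounded_le[of "bid ` C"] by auto
  define \<tau> where "\<tau> = (\<lambda>b\<in>AG. if b \<in> C then \<sigma> b
    else ({}, {}, w, if b = a then Suc m else 0))"
  show thesis
  proof (rule that)
    show "\<tau> \<in> AG \<rightarrow>\<^sub>E UNIV" by (simp add: \<tau>_def)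
    show "restrict \<tau> C = \<sigma>"
      using assms(2,3) by (auto simp: \<tau>_def fun_eq_iff restrict_def PiE_def extensional_def)
    have on_C: "\<tau> b = \<sigma> b" if "b \<in> C" for b
      using that assms(2) by (auto simp: \<tau>_def)
    have off_C: "fst (\<tau> b) = {}" if "b \<in> AG - C" for b
      using that by (simp add: \<tau>_def)
    show "enacted N AG \<tau> = enacted N C \<sigma>"
    proof (rule set_eqI, clarify)
      fix B Y
      \<comment> \<open>A member of \<open>B\<close> outside \<open>C\<close> would have named
        \<open>{}\<close> as its coalition, contradicting \<open>B \<noteq> {}\<close>.\<close>
      have "B \<subseteq> C" if "B \<noteq> {}" "B \<subseteq> AG" "\<forall>b\<in>B. \<exists>w n. \<tau> b = (B, Y, w, n)"
        using that off_C by (metis DiffI fst_conv subset_iff)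
      moreover have "(\<exists>w n. \<tau> b = (B, Y, w, n)) \<longleftrightarrow> (\<exists>w n. \<sigma> b = (B, Y, w, n))"
        if "B \<subseteq> C" "b \<in> B" for b
        using on_C that by (simp add: subset_iff)
      ultimately show "(B, Y) \<in> enacted N AG \<tau> \<longleftrightarrow> (B, Y) \<in> enacted N C \<sigma>"
        using assms(2) unfolding enacted_def by (blast intro: subset_trans)
    qed
    have "\<forall>b\<in>AG - {a}. snd (snd (snd (\<tau> b))) < Suc m"
      using m by (auto simp: \<tau>_def bid_def less_Suc_eq_le)
    moreover have "\<tau> a = ({}, {}, w, Suc m)" using a by (simp add: \<tau>_def)
    ultimately show "w \<in> drawn AG \<tau>" using a(1) unfolding drawn_def by blast
  qed
qed

text \<open>The draw leaves no trace here: an extension can only add enacted proposals, which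
  shrinks \<open>allowed\<close>, and each allowed \<open>w\<close> is reached by an abstaining
  extension of its own.\<close>

lemma coalition_outcome_proper:
  assumes "finite AG" "C \<subset> AG" "\<sigma> \<in> C \<rightarrow>\<^sub>E UNIV"
  shows "coalition_outcome det AG N W C \<sigma> = allowed W (enacted N C \<sigma>)"
proof
  show "coalition_outcome det AG N W C \<sigma> \<subseteq> allowed W (enacted N C \<sigma>)"
  proof
    fix w assume "w \<in> coalition_outcome det AG N W C \<sigma>"
    then obtain \<tau> where "w \<in> allowed W (enacted N AG \<tau>)" "restrict \<tau> C = \<sigma>"
      by (auto simp: coalition_outcome_def profile_outcome_def)
    then show "w \<in> allowed W (enacted N C \<sigma>)"
      using allowed_antimono[OF enacted_mono_restrict[of C AG N \<tau>]] assms(2) by blast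
  qed
  show "allowed W (enacted N C \<sigma>) \<subseteq> coalition_outcome det AG N W C \<sigma>"
  proof
    fix w assume w: "w \<in> allowed W (enacted N C \<sigma>)"
    obtain \<tau> where "\<tau> \<in> AG \<rightarrow>\<^sub>E UNIV" "restrict \<tau> C = \<sigma>"
      "enacted N AG \<tau> = enacted N C \<sigma>" "w \<in> drawn AG \<tau>"
      using abstaining_extension[OF assms] .
    moreover from this w have "w \<in> profile_outcome det AG N W \<tau>"
      by (simp add: profile_outcome_def)
    ultimately show "w \<in> coalition_outcome det AG N W C \<sigma>"
      unfolding coalition_outcome_def by blast
  qed
qed

lemma coalition_outcome_subset: "coalition_outcome det AG N W C \<sigma> \<subseteq> W"
  using allowed_subset by (fastforce simp: coalition_outcome_def profile_outcome_def)

section \<open>Neighborhoods at a state of an \<alpha>-representative frame\<close>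

context
  fixes AG :: "'ag set" and \<A> :: "('s, 'ag) alpha_frame" and s
  assumes rep: "alpha_representative AG \<A>" and s: "s \<in> aST \<A>"
begin

lemma anb_subset: "C \<subseteq> AG \<Longrightarrow> Y \<in> anb \<A> C s \<Longrightarrow> Y \<subseteq> aST \<A>"
  using rep s unfolding alpha_representative_def alpha_neighborhood_frame_def by blast

lemma anb_superset:
  "C \<subseteq> AG \<Longrightarrow> Y \<in> anb \<A> C s \<Longrightarrow> Y \<subseteq> Z \<Longrightarrow> Z \<subseteq> aST \<A> \<Longrightarrow> Z \<in> anb \<A> C s"
  using rep s unfolding alpha_representative_def alpha_neighborhood_frame_def by blast

lemma anb_mono: "C \<subseteq> D \<Longrightarrow> D \<subseteq> AG \<Longrightarrow> anb \<A> C s \<subseteq> anb \<A> D s"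
  using rep s unfolding alpha_representative_def by blast

lemma anb_nonempty: "C \<subseteq> AG \<Longrightarrow> Y \<in> anb \<A> C s \<Longrightarrow> Y \<noteq> {}"
  using rep s unfolding alpha_representative_def by metis

lemma anb_below:
  assumes "C \<subseteq> AG" "Z \<in> anb \<A> C s"
  obtains Y where "Y \<in> anb \<A> C s" "Y \<subseteq> \<Union>(Core \<A> {} s)" "Y \<subseteq> Z"
  using assms rep s unfolding alpha_representative_def by metis

lemma Union_Core_subset: "C \<subseteq> AG \<Longrightarrow> \<Union>(Core \<A> C s) \<subseteq> aST \<A>"
  using anb_subset[of C] unfolding Core_def by blast

text \<open>Some neighborhood lies below both sets, hence below their intersection; superset closure
  does the rest.\<close>

lemma anb_Int_Core:
  assumes "C \<subseteq> AG" "Y \<in> anb \<A> C s"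
  shows "\<Union>(Core \<A> {} s) \<inter> Y \<in> anb \<A> C s"
proof -
  obtain Z where Z: "Z \<in> anb \<A> C s" "Z \<subseteq> \<Union>(Core \<A> {} s)" "Z \<subseteq> Y"
    using anb_below[OF assms] .
  show ?thesis
    using anb_superset[OF assms(1) Z(1) Int_greatest[OF Z(2,3)]] anb_subset[OF assms]
    by (simp add: le_infI2)
qed

lemma Core_empty_coalition:
  assumes "\<Union>(Core \<A> {} s) \<noteq> {}"
  shows "Core \<A> {} s = {\<Union>(Core \<A> {} s)}"
proof -
  have "anb \<A> {} s \<noteq> {}" using assms by (auto simp: Core_def)
  then have "is_singleton (Core \<A> {} s)"
    using rep s unfolding alpha_representative_def by metis
  then show ?thesis by (auto elim: is_singletonE)
qed

lemma Union_Core_in_anb: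
  assumes "\<Union>(Core \<A> {} s) \<noteq> {}" "C \<subseteq> AG"
  shows "\<Union>(Core \<A> {} s) \<in> anb \<A> C s"
proof -
  have "\<Union>(Core \<A> {} s) \<in> anb \<A> {} s"
    using Core_empty_coalition[OF assms(1)] by (metis (lifting) Core_def mem_Collect_eq singletonI)
  then show ?thesis using anb_mono[OF empty_subsetI assms(2)] by blast
qed

text \<open>The unique minimal element \<open>?W\<close> is even least: \<open>?W \<inter> Y\<close>
  is again a neighborhood, so minimality of \<open>?W\<close> rules out that it is a proper
  subset.\<close>

lemma Union_Core_subset_anb:
  assumes "Y \<in> anb \<A> {} s"
  shows "\<Union>(Core \<A> {} s) \<subseteq> Y"
proof -
  let ?W = "\<Union>(Core \<A> {} s)"
  have *: "?W \<inter> Y \<in> anb \<A> {} s" using anb_Int_Core[OF _ assms] by simp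
  then have "?W \<noteq> {}" using anb_nonempty[OF empty_subsetI *] by auto
  then have "?W \<in> Core \<A> {} s" using Core_empty_coalition by (metis singletonI)
  then have "\<not> ?W \<inter> Y \<subset> ?W" using * by (simp add: Core_def)
  then show ?thesis by blast
qed

text \<open>Nonemptiness leaves at most one enacted proposal. Its set is a neighborhood of a
  subcoalition of \<open>C\<close>, hence of \<open>C\<close>, and stays one when intersected with
  \<open>?W\<close>.\<close>

lemma allowed_enacted_in_anb:
  assumes "C \<subseteq> AG" "allowed (\<Union>(Core \<A> {} s)) (enacted (\<lambda>B. anb \<A> B s) C \<sigma>) \<noteq> {}"
  shows "allowed (\<Union>(Core \<A> {} s)) (enacted (\<lambda>B. anb \<A> B s) C \<sigma>) \<in> anb \<A> C s"
    (is "allowed ?W ?P \<in> _")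
  using assms(2)
proof (cases rule: allowed_nonempty_cases)
  case 1
  then show ?thesis using assms Union_Core_in_anb by simp
next
  case (2 p)
  then have "p \<in> ?P" by blast
  then have "fst p \<subseteq> C" "snd p \<in> anb \<A> (fst p) s" by (auto simp: enacted_def)
  then have "snd p \<in> anb \<A> C s" using anb_mono[OF _ assms(1)] by blast
  then show ?thesis using 2 anb_Int_Core[OF assms(1)] by simp
qed

text \<open>Clause (b) of \<alpha>-determinism puts \<open>w\<close> into a core set of the grand
  coalition, and clause (a) makes that set \<open>{w}\<close>.\<close>

lemma deterministic_singleton_in_anb:
  assumes "alpha_deterministic AG \<A>" "w \<in> \<Union>(Core \<A> {} s)"
  shows "{w} \<in> anb \<A> AG s"
proof -
  obtain Y where Y: "Y \<in> Core \<A> AG s" "w \<in> Y" "is_singleton Y"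
    using assms s unfolding alpha_deterministic_def by blast
  then have "Y = {w}" by (auto simp: is_singleton_def)
  then show ?thesis using Y(1) by (simp add: Core_def)
qed

lemma coalition_outcome_in_anb:
  fixes \<sigma> :: "'ag \<Rightarrow> ('s, 'ag) rep_action"
  defines "R \<equiv> \<lambda>det C. coalition_outcome det AG (\<lambda>B. anb \<A> B s) (\<Union>(Core \<A> {} s)) C \<sigma>"
  assumes "finite AG" "det \<Longrightarrow> alpha_deterministic AG \<A>"
    and "C \<subseteq> AG" "\<sigma> \<in> C \<rightarrow>\<^sub>E UNIV" "R det C \<noteq> {}"
  shows "R det C \<in> anb \<A> C s"
proof (cases "C = AG")
  case False
  then have "R det C = allowed (\<Union>(Core \<A> {} s)) (enacted (\<lambda>B. anb \<A> B s) C \<sigma>)"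
    using assms unfolding R_def by (intro coalition_outcome_proper) auto
  then show ?thesis using allowed_enacted_in_anb[OF \<open>C \<subseteq> AG\<close>] assms(6) by simp
next
  case True
  then have R: "R det C = profile_outcome det AG (\<lambda>B. anb \<A> B s) (\<Union>(Core \<A> {} s)) \<sigma>"
    using coalition_outcome_grand assms(5) unfolding R_def by blast
  show ?thesis
  proof (cases det)
    case False
    then show ?thesis
      using R True allowed_enacted_in_anb[of AG \<sigma>] assms(6) by (simp add: profile_outcome_def)
  next
    case det: True
    \<comment> \<open>With the draw in force, a nonempty outcome is a single state of
      \<open>W\<close>.\<close>
    obtain w where w: "w \<in> R det C" using assms(6) by blast
    then have "w \<in> \<Union>(Core \<A> {} s)"
      unfolding R_def by (rule subsetD[OF coalition_outcome_subset])
    moreover have "R det C = {w}"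
      using R w det drawn_unique[of _ AG \<sigma>] by (auto simp: profile_outcome_def)
    ultimately show ?thesis
      using deterministic_singleton_in_anb assms(3) det True by simp
  qed
qed

lemma anb_forced:
  assumes "finite AG" "AG \<noteq> {}" "C \<subseteq> AG" "Y \<in> anb \<A> C s"
  obtains \<sigma> where "\<sigma> \<in> C \<rightarrow>\<^sub>E UNIV"
    "coalition_outcome det AG (\<lambda>B. anb \<A> B s) (\<Union>(Core \<A> {} s)) C \<sigma> \<noteq> {}"
    "coalition_outcome det AG (\<lambda>B. anb \<A> B s) (\<Union>(Core \<A> {} s)) C \<sigma> \<subseteq> Y"
proof -
  let ?W = "\<Union>(Core \<A> {} s)" and ?N = "\<lambda>B. anb \<A> B s"
  obtain w where w: "w \<in> ?W" "w \<in> Y"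
    using anb_nonempty[OF assms(3) anb_Int_Core[OF assms(3,4)]] by (metis Int_iff ex_in_conv)
  obtain l where l: "l \<in> AG" using assms(2) by blast
  \<comment> \<open>All of \<open>C\<close> propose \<open>(C, Y)\<close> and name the same
    \<open>w\<close>. The bids matter only if \<open>C = AG\<close>: then \<open>l\<close> is the
    unique highest bidder and \<open>w\<close> is drawn.\<close>
  define \<sigma> :: "'ag \<Rightarrow> ('s, 'ag) rep_action"
    where "\<sigma> = (\<lambda>a\<in>C. (C, Y, w, if a = l then 1 else 0))"
  have \<sigma>: "\<sigma> \<in> C \<rightarrow>\<^sub>E UNIV" by (simp add: \<sigma>_def)
  have allowed: "allowed ?W (enacted ?N C \<sigma>) = ?W \<inter> Y"
  \<comment> \<open>The empty coalition enacts nothing and forces \<open>?W\<close>, so here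
    \<open>?W \<subseteq> Y\<close> must come from \<open>?W\<close> being least.\<close>
  proof (cases "C = {}")
    case True
    then have "enacted ?N C \<sigma> = {}" by (auto simp: enacted_def)
    then show ?thesis using Union_Core_subset_anb assms(4) True by auto
  next
    case False
    have "enacted ?N C \<sigma> = {(C, Y)}"
    proof
      show "enacted ?N C \<sigma> \<subseteq> {(C, Y)}"
        by (fastforce simp: enacted_def \<sigma>_def)
      show "{(C, Y)} \<subseteq> enacted ?N C \<sigma>"
        using False assms(4) by (auto simp: enacted_def \<sigma>_def)
    qed
    then show ?thesis by simp
  qed
  have "w \<in> coalition_outcome det AG ?N ?W C \<sigma> \<and> coalition_outcome det AG ?N ?W C \<sigma> \<subseteq> Y"
  proof (cases "C = AG")
    case True
    have "w \<in> drawn AG \<sigma>" using l True by (auto simp: drawn_def \<sigma>_def)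
    then show ?thesis
      using \<sigma> w allowed True by (auto simp: coalition_outcome_grand profile_outcome_def)
  next
    case False
    then show ?thesis
      using w allowed coalition_outcome_proper[OF assms(1) _ \<sigma>] assms(3) by auto
  qed
  with \<sigma> that show thesis by blast
qed

end

section \<open>Frame conditions and representation\<close>

lemma representing_frame_simps [simp]:
  "ST (representing_frame det AG \<A>) = aST \<A>"
  "JA (representing_frame det AG \<A>) C = (C \<rightarrow>\<^sub>E UNIV)"
  "out (representing_frame det AG \<A>) C s =
     coalition_outcome det AG (\<lambda>B. anb \<A> B s) (\<Union>(Core \<A> {} s)) C"
  "av (representing_frame det AG \<A>) C s =
     {\<sigma> \<in> C \<rightarrow>\<^sub>E UNIV. out (representing_frame det AG \<A>) C s \<sigma> \<noteq> {}}"
  by (simp_all add: representing_frame_def JA_def)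

lemma general_concurrent_game_frame_representing_frame:
  assumes "alpha_representative AG \<A>"
  shows "general_concurrent_game_frame AG (representing_frame det AG \<A>)"
proof -
  let ?G = "representing_frame det AG \<A>"
  have "aST \<A> \<noteq> {}"
    using assms by (simp add: alpha_representative_def alpha_neighborhood_frame_def)
  moreover have "AC ?G \<noteq> {}" by (simp add: representing_frame_def)
  moreover have "out ?G C s \<sigma> \<subseteq> aST \<A>" if "s \<in> aST \<A>" for C s \<sigma>
    using coalition_outcome_subset Union_Core_subset[OF assms that, of "{}"] by fastforce
  ultimately have "is_action_frame AG ?G"
    unfolding is_action_frame_def by auto
  moreover have "GCI AG ?G"
    unfolding GCI_def
  proof (intro allI impI ballI)
    fix C s \<sigma>
    let ?f = "profile_outcome det AG (\<lambda>B. anb \<A> B s) (\<Union>(Core \<A> {} s))"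
    \<comment> \<open>GCI is built into \<open>coalition_outcome\<close>; it remains to identify the
      outcomes of the grand coalition with \<open>profile_outcome\<close>.\<close>
    have "{out ?G AG s \<tau> | \<tau>. \<tau> \<in> JA ?G AG \<and> restrict \<tau> C = \<sigma>}
        = {?f \<tau> | \<tau>. \<tau> \<in> AG \<rightarrow>\<^sub>E UNIV \<and> restrict \<tau> C = \<sigma>}"
      by (intro Collect_cong ex_cong1) (auto simp: coalition_outcome_grand)
    then show "out ?G C s \<sigma> = \<Union>{out ?G AG s \<tau> | \<tau>. \<tau> \<in> JA ?G AG \<and> restrict \<tau> C = \<sigma>}"
      by (simp add: coalition_outcome_def[of _ _ _ _ C])
  qed
  moreover have "ODA AG ?G" by (simp add: ODA_def)
  ultimately show ?thesis by (simp add: general_concurrent_game_frame_def)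
qed

text \<open>Availability gives at least one outcome, and uniqueness of the drawn state at most
  one.\<close>

lemma deterministic_representing_frame: "deterministic AG (representing_frame True AG \<A>)"
  unfolding deterministic_def
proof (intro ballI)
  fix s \<sigma>
  let ?G = "representing_frame True AG \<A>"
  assume "\<sigma> \<in> av ?G AG s"
  then obtain w where "w \<in> out ?G AG s \<sigma>" "\<sigma> \<in> AG \<rightarrow>\<^sub>E UNIV" by auto
  then have "out ?G AG s \<sigma> = {w}"
    using drawn_unique[of _ AG \<sigma>]
    by (auto simp: coalition_outcome_grand profile_outcome_def)
  then show "is_singleton (out ?G AG s \<sigma>)" by (simp add: is_singleton_def)
qed

lemma alpha_representable_by_representing_frame:
  assumes "finite AG" "AG \<noteq> {}" "alpha_representative AG \<A>"
    and "det \<Longrightarrow> alpha_deterministic AG \<A>"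
  shows "alpha_representable_by AG (representing_frame det AG \<A>) \<A>"
  unfolding alpha_representable_by_def
proof (intro conjI ballI allI impI)
  let ?G = "representing_frame det AG \<A>"
  fix s C assume s: "s \<in> aST \<A>" and C: "C \<subseteq> AG"
  show "anb \<A> C s = {Y. Y \<subseteq> aST \<A> \<and> (\<exists>\<sigma>\<in>av ?G C s. out ?G C s \<sigma> \<subseteq> Y)}"
  proof (intro set_eqI iffI CollectI conjI)
    fix Y assume Y: "Y \<in> anb \<A> C s"
    then show "Y \<subseteq> aST \<A>" using anb_subset[OF assms(3) s C] by blast
    show "\<exists>\<sigma>\<in>av ?G C s. out ?G C s \<sigma> \<subseteq> Y"
      by (rule anb_forced[OF assms(3) s assms(1,2) C Y, of det]) auto
  next
    fix Y assume "Y \<in> {Y. Y \<subseteq> aST \<A> \<and> (\<exists>\<sigma>\<in>av ?G C s. out ?G C s \<sigma> \<subseteq> Y)}"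
    then obtain \<sigma> where "Y \<subseteq> aST \<A>" "\<sigma> \<in> C \<rightarrow>\<^sub>E UNIV"
      "out ?G C s \<sigma> \<noteq> {}" "out ?G C s \<sigma> \<subseteq> Y"
      by auto
    then show "Y \<in> anb \<A> C s"
      using coalition_outcome_in_anb[OF assms(3) s assms(1) assms(4) C]
        anb_superset[OF assms(3) s C] by (metis representing_frame_simps(3))
  qed
qed simp

text \<open>Seriality transfers along any representation: a neighborhood in
  \<open>anb \<A> C s\<close> is witnessed by an available joint action of \<open>C\<close>.\<close>

lemma serial_if_representable:
  assumes "alpha_representable_by AG G \<A>" "alpha_serial AG \<A>"
  shows "serial AG G"
  unfolding serial_def
proof (intro allI impI)
  fix C s assume C: "C \<subseteq> AG" and "s \<in> ST G"
  with assms(1) have s: "s \<in> aST \<A>" by (simp add: alpha_representable_by_def)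
  then have "anb \<A> C s \<noteq> {}" using assms(2) C by (simp add: alpha_serial_def)
  moreover have "anb \<A> C s = {Y. Y \<subseteq> aST \<A> \<and> (\<exists>\<sigma>\<in>av G C s. out G C s \<sigma> \<subseteq> Y)}"
    using assms(1) C s by (simp add: alpha_representable_by_def)
  ultimately show "av G C s \<noteq> {}" by auto
qed

theorem theorem8:
  fixes AG :: "'ag set"
    and X :: "frame_symbol set"
    and \<A> :: "('s, 'ag) alpha_frame"
  assumes "finite AG" and "AG \<noteq> {}"
    and "alpha_representative_X_frame X AG \<A>"
  shows "\<exists>G :: ('s, 'ag, ('s, 'ag) rep_action) action_frame.
           general_concurrent_game_X_frame X AG G \<and>
           ST G = aST \<A> \<and>
           alpha_representable_by AG G \<A>"
proof (intro exI conjI)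
  let ?G = "representing_frame (Deterministic \<in> X) AG \<A>"
  have rep: "alpha_representative AG \<A>"
    and ser: "Serial \<in> X \<Longrightarrow> alpha_serial AG \<A>"
    and det: "Deterministic \<in> X \<Longrightarrow> alpha_deterministic AG \<A>"
    using assms(3) by (auto simp: alpha_representative_X_frame_def)
  show representable: "alpha_representable_by AG ?G \<A>"
    using alpha_representable_by_representing_frame[OF assms(1,2) rep det] .
  show "general_concurrent_game_X_frame X AG ?G"
    using general_concurrent_game_frame_representing_frame[OF rep]
      serial_if_representable[OF representable ser] deterministic_representing_frame
    by (auto simp: general_concurrent_game_X_frame_def)
  show "ST ?G = aST \<A>" by simp
qed

end
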